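(* Let $(\sigma,\mathbf{i})$ be an $e$-admissible pair of $\mathbb{M}\mathbb{C}(n)$, let $U\subseteq\mathbb{M}\mathbb{C}(n)$ be open, let $m=2^{n-1}$, and consider functions $F:U\to\mathbb{M}\mathbb{C}(n)$ of class $C^2$. Let $(u_\ell,v_\ell)_{0\le\ell\le m-1}$ be the real coordinates associated with a real basis $\beta_0=1,\beta_1,\dots,\beta_{m-1}$ of $\mathcal{B}_\sigma$. Then, acting on such $F$, for every $0\le\ell\le m-1$, $$\partial_\ell^{\,\sigma,\mathbf{i}}\,\overline{\partial}_\ell^{\,\sigma,\mathbf{i}}=\overline{\partial}_\ell^{\,\sigma,\mathbf{i}}\,\partial_\ell^{\,\sigma,\mathbf{i}}=\frac14\Big(\frac{\partial^2}{\partial u_\ell^2}+\frac{\partial^2}{\partial v_\ell^2}\Big),$$ so that $$\Delta_\sigma:=\sum_{\ell=0}^{m-1}\Big(\frac{\partial^2}{\partial u_\ell^2}+\frac{\partial^2}{\partial v_\ell^2}\Big)=4\sum_{\ell=0}^{m-1}\overline{\partial}_\ell^{\,\sigma,\mathbf{i}}\,\partial_\ell^{\,\sigma,\mathbf{i}}.$$ Moreover, the real basis $\beta_0=1,\beta_1,\dots,\beta_{m-1}$ of $\mathcal{B}_\sigma$ may be chosen so that $$\Delta_\sigma=\Delta:=\sum_{\vec{b}\in\mathbb{F}_2^n}\frac{\partial^2}{\partial x_{\vec{b}}^2},$$ where $\Delta$ is the standard Laplacian in the canonical coordinates $x_{\vec{b}}$; for this choice, $\Delta_\sigma$ is independent of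 $\sigma$ and of the basis.
   Context: Let $n\ge1$. The multicomplex numbers are defined recursively by $\mathbb{M}\mathbb{C}(0)=\mathbb{R}$ and $\mathbb{M}\mathbb{C}(n)=\{\eta_1+\eta_2\mathbf{i}_n:\eta_1,\eta_2\in\mathbb{M}\mathbb{C}(n-1)\}$ with $\mathbf{i}_n^2=-1$, where $\mathbf{i}_n$ is a new formal square root of $-1$ commuting with everything. Thus $\mathbb{M}\mathbb{C}(n)$ is a commutative unital real algebra of dimension $2^n$ generated by commuting units $\mathbf{i}_1,\dots,\mathbf{i}_n$ with $\mathbf{i}_k^2=-1$. For $\vec{b}\in\mathbb{F}_2^n$ put $\mathbf{i}^{\vec{b}}:=\mathbf{i}_1^{b_1}\cdots\mathbf{i}_n^{b_n}$; these $2^n$ monomials form a real basis, denoted $\mathbb{I}(n)$, and the canonical coordinates $x_{\vec{b}}\in\mathbb{R}$ are defined by $\eta=\sum_{\vec{b}}x_{\vec{b}}\mathbf{i}^{\vec{b}}$. Put $\pm\mathbb{I}(n):=\{\pm\mathbf{j}:\mathbf{j}\in\mathbb{I}(n)\}$. An involution of $\mathbb{M}\mathbb{C}(n)$ is a real-linear multiplicative map $\sigma$ with $\sigma\circ\sigma=\mathrm{Id}$; it is $\mathbb{I}(n)$-preserving if it maps $\mathbb{I}(n)$ into $\pm\mathbb{I}(n)$. An $e$-admissible pair $(\sigma,\mathbf{i})$ consists of an $\mathbb{I}(n)$-preserving involution $\sigma$ and an element $\mathbf{i}\in\mathbb{I}(n)$ with $\mathbf{i}^2=-1$ and $\sigma(\mathbf{i})=-\mathbf{i}$.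 Let $\mathcal{B}_\sigma:=\{\eta:\sigma(\eta)=\eta\}$. One has $\mathbb{M}\mathbb{C}(n)=\mathcal{B}_\sigma\oplus\mathbf{i}\mathcal{B}_\sigma$ and $\dim_{\mathbb{R}}\mathcal{B}_\sigma=m=2^{n-1}$; given a real basis $\beta_0=1,\beta_1,\dots,\beta_{m-1}$ of $\mathcal{B}_\sigma$, each $\eta$ is uniquely $\eta=\sum_{\ell=0}^{m-1}(u_\ell+\mathbf{i}v_\ell)\beta_\ell$ with $u_\ell,v_\ell\in\mathbb{R}$, which defines real coordinates on $\mathbb{M}\mathbb{C}(n)$. The Wirtinger-type operators are $$\overline{\partial}_\ell^{\,\sigma,\mathbf{i}}:=\frac12\Big(\frac{\partial}{\partial u_\ell}+\mathbf{i}\frac{\partial}{\partial v_\ell}\Big),\qquad \partial_\ell^{\,\sigma,\mathbf{i}}:=\frac12\Big(\frac{\partial}{\partial u_\ell}-\mathbf{i}\frac{\partial}{\partial v_\ell}\Big).$$ Class $C^2$ is in the sense of maps between real vector spaces. *)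

theory Defs
  imports "HOL-Analysis.Analysis" "HOL-Library.Z2"
begin

section \<open>The algebra of multicomplex numbers\<close>

instance bit :: finite
proof
  have "(UNIV :: bit set) = {0, 1}"
    by auto
  then show "finite (UNIV :: bit set)"
    by (metis finite.emptyI finite_insert)
qed

text \<open>
  The number \<open>n \<ge> 1\<close> of imaginary units is \<open>CARD('n)\<close>, the units being indexed by \<open>'n\<close>, and
  \<open>bit ^ 'n\<close> is the vector space of exponent vectors over the two-element field. An element is
  given by its \<open>2 ^ n\<close> real coordinates \<open>x\<^sub>b\<close>. The recursive construction
  (real numbers first, then adjoining one square root of \<open>-1\<close> at a time) is recovered in
  \<open>mc_stage_empty\<close>, \<open>mc_stage_insert\<close>, \<open>mc_stage_insert_unique\<close>, \<open>mc_stage_UNIV\<close> below.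
\<close>

typedef (overloaded) 'n multicomplex = "UNIV :: (real ^ (bit ^ 'n)) set"
  morphisms mc_vec Mc ..

setup_lifting type_definition_multicomplex

instantiation multicomplex :: (finite) real_vector
begin

lift_definition zero_multicomplex :: "'a multicomplex" is 0 .
lift_definition plus_multicomplex :: "'a multicomplex \<Rightarrow> 'a multicomplex \<Rightarrow> 'a multicomplex" is "(+)" .
lift_definition minus_multicomplex :: "'a multicomplex \<Rightarrow> 'a multicomplex \<Rightarrow> 'a multicomplex" is "(-)" .
lift_definition uminus_multicomplex :: "'a multicomplex \<Rightarrow> 'a multicomplex" is uminus .
lift_definition scaleR_multicomplex :: "real \<Rightarrow> 'a multicomplex \<Rightarrow> 'a multicomplex" is scaleR .

instance
  by standard (transfer; simp add: algebra_simps)+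

end

text \<open>
  The Euclidean structure in the canonical coordinates; it only serves to provide the topology of
  the finite-dimensional real vector space.
\<close>

instantiation multicomplex :: (finite) euclidean_space
begin

definition inner_multicomplex :: "'a multicomplex \<Rightarrow> 'a multicomplex \<Rightarrow> real"
  where "inner_multicomplex x y = inner (mc_vec x) (mc_vec y)"

definition norm_multicomplex :: "'a multicomplex \<Rightarrow> real"
  where "norm_multicomplex x = norm (mc_vec x)"

definition sgn_multicomplex :: "'a multicomplex \<Rightarrow> 'a multicomplex"
  where "sgn_multicomplex x = inverse (norm x) *\<^sub>R x"

definition dist_multicomplex :: "'a multicomplex \<Rightarrow> 'a multicomplex \<Rightarrow> real"
  where "dist_multicomplex x y = norm (x - y)"

definition uniformity_multicomplex :: "('a multicomplex \<times> 'a multicomplex) filter"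
  where "uniformity_multicomplex = (INF e\<in>{0<..}. principal {(x, y). dist x y < e})"

definition open_multicomplex :: "'a multicomplex set \<Rightarrow> bool"
  where "open_multicomplex U \<longleftrightarrow> (\<forall>x\<in>U. eventually (\<lambda>(x', y). x' = x \<longrightarrow> y \<in> U) uniformity)"

definition Basis_multicomplex :: "'a multicomplex set"
  where "Basis_multicomplex = Mc ` Basis"

instance
proof
  fix x y z :: "'a multicomplex" and r :: real and U :: "'a multicomplex set"
  show "dist x y = norm (x - y)" by (rule dist_multicomplex_def)
  show "sgn x = x /\<^sub>R norm x" by (simp add: sgn_multicomplex_def)
  show "uniformity = (INF e\<in>{0<..}. principal {(x, y). dist (x::'a multicomplex) y < e})"
    by (rule uniformity_multicomplex_def)
  show "open U = (\<forall>x\<in>U. \<forall>\<^sub>F (x', y) in uniformity. x' = x \<longrightarrow> y \<in> U)"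
    by (rule open_multicomplex_def)
  show "inner x y = inner y x"
    by (simp add: inner_multicomplex_def inner_commute)
  show "inner (x + y) z = inner x z + inner y z"
    by (simp add: inner_multicomplex_def plus_multicomplex.rep_eq inner_add_left)
  show "inner (r *\<^sub>R x) y = r * inner x y"
    by (simp add: inner_multicomplex_def scaleR_multicomplex.rep_eq)
  show "0 \<le> inner x x"
    by (simp add: inner_multicomplex_def)
  show "(inner x x = 0) = (x = 0)"
    by (simp add: inner_multicomplex_def zero_multicomplex.rep_eq flip: mc_vec_inject)
  show "norm x = sqrt (inner x x)"
    by (simp add: inner_multicomplex_def norm_multicomplex_def norm_eq_sqrt_inner)
  show "(Basis :: 'a multicomplex set) \<noteq> {}"
    by (simp add: Basis_multicomplex_def)
  show "finite (Basis :: 'a multicomplex set)"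
    by (simp add: Basis_multicomplex_def)
  show "(\<forall>u\<in>Basis. inner x u = 0) \<longleftrightarrow> x = 0"
    by (simp add: Basis_multicomplex_def inner_multicomplex_def Mc_inverse euclidean_all_zero_iff
        zero_multicomplex.rep_eq flip: mc_vec_inject)
next
  fix x y :: "'a multicomplex"
  assume "x \<in> Basis" "y \<in> Basis"
  then show "inner x y = (if x = y then 1 else 0)"
    by (auto simp: Basis_multicomplex_def inner_multicomplex_def Mc_inverse inner_Basis Mc_inject)
qed

end

definition mc_coord :: "'n::finite multicomplex \<Rightarrow> bit ^ 'n \<Rightarrow> real"
  where "mc_coord \<eta> b = mc_vec \<eta> $ b"

text \<open>
  Since \<open>\<i>\<^sub>k\<^sup>2 = -1\<close>, the product of the monomials with exponents \<open>b\<close> and \<open>c\<close> is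
  \<open>mc_sign b c\<close> times the monomial with exponent \<open>b + c\<close>.
\<close>

definition mc_sign :: "bit ^ 'n::finite \<Rightarrow> bit ^ 'n \<Rightarrow> real"
  where "mc_sign b c = (\<Prod>k\<in>UNIV. if b $ k = 1 \<and> c $ k = 1 then - 1 else 1)"

lemma mc_coord_eqI: "(\<And>b. mc_coord x b = mc_coord y b) \<Longrightarrow> x = y"
  by (simp add: mc_coord_def vec_eq_iff flip: mc_vec_inject)

lemma mc_coord_simps [simp]:
  "mc_coord 0 b = 0"
  "mc_coord (x + y) b = mc_coord x b + mc_coord y b"
  "mc_coord (x - y) b = mc_coord x b - mc_coord y b"
  "mc_coord (- x) b = - mc_coord x b"
  "mc_coord (r *\<^sub>R x) b = r * mc_coord x b"
  by (simp_all add: mc_coord_def zero_multicomplex.rep_eq plus_multicomplex.rep_eq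
      minus_multicomplex.rep_eq uminus_multicomplex.rep_eq scaleR_multicomplex.rep_eq)

lemma mc_coord_sum: "mc_coord (sum f A) b = (\<Sum>a\<in>A. mc_coord (f a) b)"
  by (induction A rule: infinite_finite_induct) simp_all

lemma mc_coord_Mc [simp]: "mc_coord (Mc v) b = v $ b"
  by (simp add: mc_coord_def Mc_inverse)

lemma mc_sign_commute: "mc_sign b c = mc_sign c b"
  unfolding mc_sign_def by (rule prod.cong) auto

lemma mc_sign_0 [simp]: "mc_sign 0 c = 1" "mc_sign c 0 = 1"
  by (simp_all add: mc_sign_def)

lemma mc_sign_cocycle:
  "mc_sign b c * mc_sign (b + c) d = mc_sign b (c + d) * mc_sign c d"
proof -
  have "(if b $ k = 1 \<and> c $ k = 1 then - 1 else 1 :: real) *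
        (if (b + c) $ k = 1 \<and> d $ k = 1 then - 1 else 1) =
        (if b $ k = 1 \<and> (c + d) $ k = 1 then - 1 else 1) *
        (if c $ k = 1 \<and> d $ k = 1 then - 1 else 1)" for k
    by (cases "b $ k"; cases "c $ k"; cases "d $ k") simp_all
  then show ?thesis
    unfolding mc_sign_def prod.distrib [symmetric] by (intro prod.cong) auto
qed

lemma bitvec_double [simp]: "b + b = 0" "b + (b + c) = c" for b c :: "bit ^ 'n::finite"
  by (simp_all add: vec_eq_iff flip: add.assoc)

lemma bitvec_diff: "b - c = b + c" for b c :: "bit ^ 'n::finite"
  by (simp add: vec_eq_iff)

lemma sum_bitvec_shift: "(\<Sum>b\<in>UNIV. f (a + b)) = (\<Sum>b\<in>UNIV. f b)"
  for a :: "bit ^ 'n::finite"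
  by (rule sum.reindex_bij_witness [of _ "\<lambda>b. a + b" "\<lambda>b. a + b"]) simp_all

instantiation multicomplex :: (finite) "{comm_ring_1, real_algebra_1}"
begin

definition one_multicomplex :: "'a multicomplex"
  where "one_multicomplex = Mc (axis 0 1)"

definition times_multicomplex :: "'a multicomplex \<Rightarrow> 'a multicomplex \<Rightarrow> 'a multicomplex"
  where "times_multicomplex x y =
    Mc (\<chi> d. \<Sum>b\<in>UNIV. mc_sign b (d - b) * mc_coord x b * mc_coord y (d - b))"

lemma mc_coord_times:
  "mc_coord (x * y) d = (\<Sum>b\<in>UNIV. mc_sign b (b + d) * mc_coord x b * mc_coord y (b + d))"
  by (simp add: times_multicomplex_def bitvec_diff add.commute)

lemma mc_coord_one: "mc_coord 1 d = (if d = 0 then 1 else 0)"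
  by (simp add: one_multicomplex_def axis_def)

instance
proof
  fix x y z :: "'a multicomplex" and r :: real
  show *: "x * y = y * x" for x y :: "'a multicomplex"
  proof (rule mc_coord_eqI)
    fix d
    show "mc_coord (x * y) d = mc_coord (y * x) d"
      unfolding mc_coord_times
      by (subst (2) sum_bitvec_shift [where a = d, symmetric])
        (simp add: add_ac mc_sign_commute mult_ac add.commute [of d])
  qed
  show "x * y * z = x * (y * z)"
  proof (rule mc_coord_eqI)
    fix d
    have "mc_coord (x * y * z) d = (\<Sum>c\<in>UNIV. \<Sum>b\<in>UNIV.
        (mc_sign b (b + c) * mc_sign c (c + d)) * (mc_coord x b * mc_coord y (b + c) * mc_coord z (c + d)))"
      by (simp add: mc_coord_times sum_distrib_left sum_distrib_right mult_ac)
    also have "\<dots> = (\<Sum>b\<in>UNIV. \<Sum>c\<in>UNIV.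
        (mc_sign b (b + c) * mc_sign c (c + d)) * (mc_coord x b * mc_coord y (b + c) * mc_coord z (c + d)))"
      by (rule sum.swap)
    also have "\<dots> = (\<Sum>b\<in>UNIV. \<Sum>c\<in>UNIV.
        (mc_sign b (b + d) * mc_sign (b + c) (c + d)) * (mc_coord x b * mc_coord y (b + c) * mc_coord z (c + d)))"
    proof -
      have "mc_sign b (b + c) * mc_sign c (c + d) = mc_sign b (b + d) * mc_sign (b + c) (c + d)" for b c
        using mc_sign_cocycle [of b "b + c" "c + d"] by (simp add: add_ac add.left_commute)
      then show ?thesis by simp
    qed
    also have "\<dots> = (\<Sum>b\<in>UNIV. \<Sum>c\<in>UNIV.
        (mc_sign b (b + d) * mc_sign c (c + (b + d))) * (mc_coord x b * mc_coord y c * mc_coord z (c + (b + d))))"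
    proof (rule sum.cong [OF refl])
      fix b
      show "(\<Sum>c\<in>UNIV. (mc_sign b (b + d) * mc_sign (b + c) (c + d)) * (mc_coord x b * mc_coord y (b + c) * mc_coord z (c + d))) =
        (\<Sum>c\<in>UNIV. (mc_sign b (b + d) * mc_sign c (c + (b + d))) * (mc_coord x b * mc_coord y c * mc_coord z (c + (b + d))))"
        by (subst sum_bitvec_shift [where a = b, symmetric]) (simp add: add_ac)
    qed
    also have "\<dots> = mc_coord (x * (y * z)) d"
      by (simp add: mc_coord_times sum_distrib_left sum_distrib_right mult_ac)
    finally show "mc_coord (x * y * z) d = mc_coord (x * (y * z)) d" .
  qed
  show one: "1 * x = x" for x :: "'a multicomplex"
  proof (rule mc_coord_eqI)
    fix d
    show "mc_coord (1 * x) d = mc_coord x d"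
      by (simp add: mc_coord_times mc_coord_one if_distrib [of "\<lambda>t. t * _"] if_distrib [of "\<lambda>t. _ * t"]
          cong: if_cong)
  qed
  show "x * 1 = x"
    by (simp add: * [of x 1] one)
  show distrib: "(x + y) * z = x * z + y * z" for x y z :: "'a multicomplex"
    by (rule mc_coord_eqI) (simp add: mc_coord_times algebra_simps sum.distrib)
  show "x * (y + z) = x * y + x * z"
    by (simp add: * [of x] distrib)
  show "0 \<noteq> (1 :: 'a multicomplex)"
    by (metis mc_coord_one mc_coord_simps(1) zero_neq_one)
  show **: "r *\<^sub>R x * y = r *\<^sub>R (x * y)" for x y :: "'a multicomplex"
    by (rule mc_coord_eqI) (simp add: mc_coord_times sum_distrib_left mult_ac)
  show "x * r *\<^sub>R y = r *\<^sub>R (x * y)"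
    using ** [of y x] by (simp add: *)
qed

end

definition mc_unit :: "'n::finite \<Rightarrow> 'n multicomplex"
  where "mc_unit k = Mc (axis (axis k 1) 1)"

definition mc_monomial :: "bit ^ 'n \<Rightarrow> 'n::finite multicomplex"
  where "mc_monomial b = (\<Prod>k\<in>UNIV. if b $ k = 1 then mc_unit k else 1)"

definition mc_monomials :: "'n::finite multicomplex set"
  where "mc_monomials = range mc_monomial"

definition mc_pm_monomials :: "'n::finite multicomplex set"
  where "mc_pm_monomials = mc_monomials \<union> uminus ` mc_monomials"

lemma Mc_axis_mult:
  "Mc (axis b 1) * Mc (axis c 1) = mc_sign b c *\<^sub>R Mc (axis (b + c) 1)"
proof (rule mc_coord_eqI)
  fix d
  have "mc_coord (Mc (axis b 1) * Mc (axis c 1)) d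
    = (\<Sum>b'\<in>UNIV. if b' = b then mc_sign b (b + d) * (if b + d = c then 1 else 0) else 0)"
    unfolding mc_coord_times by (rule sum.cong) (auto simp: axis_def)
  also have "\<dots> = mc_sign b (b + d) * (if b + d = c then 1 else 0)"
    by simp
  also have "\<dots> = mc_coord (mc_sign b c *\<^sub>R Mc (axis (b + c) 1)) d"
    by (auto simp: axis_def)
  finally show "mc_coord (Mc (axis b 1) * Mc (axis c 1)) d
    = mc_coord (mc_sign b c *\<^sub>R Mc (axis (b + c) 1)) d" .
qed

lemma mc_unit_square: "mc_unit k * mc_unit k = - 1"
proof -
  have "mc_sign (axis k 1) (axis k 1) = (\<Prod>j\<in>UNIV. if j = k then - 1 else 1)"
    unfolding mc_sign_def by (rule prod.cong) (auto simp: axis_def)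
  then show ?thesis
    by (simp add: mc_unit_def Mc_axis_mult one_multicomplex_def)
qed

lemma mc_monomial_eq: "mc_monomial b = Mc (axis b 1)"
proof -
  have "(\<Prod>k\<in>S. if b $ k = 1 then mc_unit k else 1)
      = Mc (axis (\<chi> k. if k \<in> S then b $ k else 0) 1)" for S
  proof (induction S rule: infinite_finite_induct)
    case (insert k S)
    let ?c = "\<chi> k. if k \<in> S then b $ k else 0"
    show ?case
    proof (cases "b $ k = 1")
      case True
      have "mc_sign (axis k 1) ?c = 1"
        unfolding mc_sign_def using insert.hyps
        by (intro prod.neutral) (auto simp: axis_def)
      moreover have "axis k 1 + ?c = (\<chi> j. if j \<in> insert k S then b $ j else 0)"
        using insert.hyps True by (auto simp: vec_eq_iff axis_def)
      ultimately show ?thesis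
        using insert True by (simp add: mc_unit_def Mc_axis_mult)
    next
      case False
      then have "?c = (\<chi> j. if j \<in> insert k S then b $ j else 0)"
        by (auto simp: vec_eq_iff)
      then show ?thesis
        using insert False by simp
    qed
  qed (simp_all add: one_multicomplex_def zero_vec_def)
  from this [of UNIV] show ?thesis
    by (simp add: mc_monomial_def)
qed

lemma mc_expansion: "\<eta> = (\<Sum>b\<in>UNIV. mc_coord \<eta> b *\<^sub>R mc_monomial b)"
  by (rule mc_coord_eqI)
    (simp add: mc_coord_sum mc_monomial_eq axis_def if_distrib [of "\<lambda>t. _ * t"] cong: if_cong)

text \<open>The subalgebra generated by the units with index in \<open>S\<close>.\<close>

definition mc_stage :: "'n::finite set \<Rightarrow> 'n multicomplex set"
  where "mc_stage S = {\<eta>. \<forall>b. mc_coord \<eta> b \<noteq> 0 \<longrightarrow> (\<forall>k. k \<notin> S \<longrightarrow> b $ k = 0)}"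

lemma mc_stage_UNIV: "mc_stage UNIV = UNIV"
  by (simp add: mc_stage_def)

lemma mc_stage_empty: "mc_stage {} = range of_real"
proof (intro subset_antisym subsetI)
  fix \<eta> :: "'n::finite multicomplex" assume "\<eta> \<in> mc_stage {}"
  then have "mc_coord \<eta> b = 0" if "b \<noteq> 0" for b
    using that by (auto simp: mc_stage_def vec_eq_iff [of b 0])
  then have "\<eta> = of_real (mc_coord \<eta> 0)"
    by (intro mc_coord_eqI) (auto simp: of_real_def mc_coord_one)
  then show "\<eta> \<in> range of_real"
    by blast
qed (auto simp: mc_stage_def of_real_def mc_coord_one split: if_splits)

lemma mc_coord_mult_unit:
  "mc_coord (\<eta> * mc_unit k) d = (if d $ k = 1 then 1 else - 1) * mc_coord \<eta> (d + axis k 1)"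
proof -
  have "mc_coord (\<eta> * mc_unit k) d
    = (\<Sum>b\<in>UNIV. if b = d + axis k 1 then mc_sign b (b + d) * mc_coord \<eta> b else 0)"
    unfolding mc_coord_times mc_unit_def
  proof (rule sum.cong)
    fix b
    have "(b + d = axis k 1) = (b = d + axis k 1)"
      by (metis add.commute bitvec_double(2))
    then show "mc_sign b (b + d) * mc_coord \<eta> b * mc_coord (Mc (axis (axis k 1) 1)) (b + d) =
        (if b = d + axis k 1 then mc_sign b (b + d) * mc_coord \<eta> b else 0)"
      by (auto simp: axis_def)
  qed simp
  also have "\<dots> = mc_sign (d + axis k 1) (axis k 1) * mc_coord \<eta> (d + axis k 1)"
  proof -
    have "(d + axis k 1) + d = axis k 1"
      by (metis add.commute bitvec_double(2))
    then show ?thesis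
      by simp
  qed
  also have "mc_sign (d + axis k 1) (axis k 1) = (\<Prod>j\<in>UNIV. if j = k then (if d $ k = 1 then 1 else - 1) else 1)"
    unfolding mc_sign_def by (rule prod.cong) (auto simp: axis_def)
  finally show ?thesis
    by simp
qed

lemma mc_stage_insert:
  assumes "k \<notin> S"
  shows "mc_stage (insert k S) =
    {\<eta>\<^sub>1 + \<eta>\<^sub>2 * mc_unit k | \<eta>\<^sub>1 \<eta>\<^sub>2. \<eta>\<^sub>1 \<in> mc_stage S \<and> \<eta>\<^sub>2 \<in> mc_stage S}"
proof (intro subset_antisym subsetI)
  fix \<eta> assume *: "\<eta> \<in> mc_stage (insert k S)"
  define \<eta>1 where "\<eta>1 = Mc (\<chi> b. if b $ k = 1 then 0 else mc_coord \<eta> b)"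
  define \<eta>2 where "\<eta>2 = Mc (\<chi> b. if b $ k = 1 then 0 else mc_coord \<eta> (b + axis k 1))"
  have "\<eta> = \<eta>1 + \<eta>2 * mc_unit k"
  proof (rule mc_coord_eqI)
    fix b
    show "mc_coord \<eta> b = mc_coord (\<eta>1 + \<eta>2 * mc_unit k) b"
      by (simp add: mc_coord_mult_unit \<eta>1_def \<eta>2_def add.assoc)
  qed
  moreover have "\<eta>1 \<in> mc_stage S"
    using * by (auto simp: mc_stage_def \<eta>1_def)
  moreover have "\<eta>2 \<in> mc_stage S"
    unfolding mc_stage_def
  proof (safe)
    fix b j assume b: "mc_coord \<eta>2 b \<noteq> 0" and j: "j \<notin> S"
    show "b $ j = 0"
    proof (cases "j = k")
      case False
      with b j * have "(b + axis k 1) $ j = 0"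
        unfolding mc_stage_def \<eta>2_def by (auto split: if_splits)
      then show ?thesis
        using False by (simp add: axis_def)
    qed (use b in \<open>auto simp: \<eta>2_def split: if_splits\<close>)
  qed
  ultimately show "\<eta> \<in> {\<eta>\<^sub>1 + \<eta>\<^sub>2 * mc_unit k | \<eta>\<^sub>1 \<eta>\<^sub>2. \<eta>\<^sub>1 \<in> mc_stage S \<and> \<eta>\<^sub>2 \<in> mc_stage S}"
    by blast
next
  fix \<eta> assume "\<eta> \<in> {\<eta>\<^sub>1 + \<eta>\<^sub>2 * mc_unit k | \<eta>\<^sub>1 \<eta>\<^sub>2. \<eta>\<^sub>1 \<in> mc_stage S \<and> \<eta>\<^sub>2 \<in> mc_stage S}"
  then obtain \<eta>1 \<eta>2 where \<eta>: "\<eta> = \<eta>1 + \<eta>2 * mc_unit k" "\<eta>1 \<in> mc_stage S" "\<eta>2 \<in> mc_stage S"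
    by blast
  show "\<eta> \<in> mc_stage (insert k S)"
    unfolding mc_stage_def
  proof (intro CollectI allI impI)
    fix b j assume b: "mc_coord \<eta> b \<noteq> 0" and j: "j \<notin> insert k S"
    then have "mc_coord \<eta>1 b \<noteq> 0 \<or> mc_coord \<eta>2 (b + axis k 1) \<noteq> 0"
      by (auto simp: \<eta>(1) mc_coord_mult_unit)
    then have "b $ j = 0 \<or> (b + axis k 1) $ j = 0"
      using \<eta>(2,3) j unfolding mc_stage_def by blast
    then show "b $ j = 0"
      using j by (auto simp: axis_def)
  qed
qed

lemma mc_stage_insert_unique:
  assumes "k \<notin> S" "\<eta>\<^sub>1 \<in> mc_stage S" "\<eta>\<^sub>2 \<in> mc_stage S" "\<theta>\<^sub>1 \<in> mc_stage S" "\<theta>\<^sub>2 \<in> mc_stage S"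
    and eq: "\<eta>\<^sub>1 + \<eta>\<^sub>2 * mc_unit k = \<theta>\<^sub>1 + \<theta>\<^sub>2 * mc_unit k"
  shows "\<eta>\<^sub>1 = \<theta>\<^sub>1 \<and> \<eta>\<^sub>2 = \<theta>\<^sub>2"
proof -
  have 0: "mc_coord \<zeta> b = 0" if "\<zeta> \<in> mc_stage S" "b $ k = 1" for \<zeta> b
    using that \<open>k \<notin> S\<close> unfolding mc_stage_def by force
  have c: "mc_coord \<eta>\<^sub>1 b + (if b $ k = 1 then 1 else - 1) * mc_coord \<eta>\<^sub>2 (b + axis k 1)
      = mc_coord \<theta>\<^sub>1 b + (if b $ k = 1 then 1 else - 1) * mc_coord \<theta>\<^sub>2 (b + axis k 1)" for b
    using arg_cong [OF eq, of "\<lambda>x. mc_coord x b"] by (simp add: mc_coord_mult_unit)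
  have "mc_coord \<eta>\<^sub>1 b = mc_coord \<theta>\<^sub>1 b" for b
    using c [of b] 0 assms(2-5) by (cases "b $ k") auto
  moreover have "mc_coord \<eta>\<^sub>2 b = mc_coord \<theta>\<^sub>2 b" for b
    using c [of "b + axis k 1"] 0 assms(2-5) by (cases "b $ k") (auto simp: add.assoc)
  ultimately show ?thesis
    by (auto intro: mc_coord_eqI)
qed


section \<open>Admissible pairs and the associated real coordinates\<close>

definition mc_involution :: "('n::finite multicomplex \<Rightarrow> 'n multicomplex) \<Rightarrow> bool"
  where "mc_involution \<sigma> \<longleftrightarrow>
    linear \<sigma> \<and> (\<forall>x y. \<sigma> (x * y) = \<sigma> x * \<sigma> y) \<and> \<sigma> \<circ> \<sigma> = id"

definition monomial_preserving :: "('n::finite multicomplex \<Rightarrow> 'n multicomplex) \<Rightarrow> bool"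
  where "monomial_preserving \<sigma> \<longleftrightarrow> \<sigma> ` mc_monomials \<subseteq> mc_pm_monomials"

definition e_admissible ::
  "('n::finite multicomplex \<Rightarrow> 'n multicomplex) \<Rightarrow> 'n multicomplex \<Rightarrow> bool"
  where "e_admissible \<sigma> i \<longleftrightarrow>
    mc_involution \<sigma> \<and> monomial_preserving \<sigma> \<and> i \<in> mc_monomials \<and> i\<^sup>2 = - 1 \<and> \<sigma> i = - i"

definition fixed_space :: "('n::finite multicomplex \<Rightarrow> 'n multicomplex) \<Rightarrow> 'n multicomplex set"
  where "fixed_space \<sigma> = {\<eta>. \<sigma> \<eta> = \<eta>}"

text \<open>Bases are families \<open>\<beta> 0, \<dots>, \<beta> (m - 1)\<close>; the values of \<open>\<beta>\<close> from \<open>m\<close> on are irrelevant.\<close>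

definition fixed_basis ::
  "('n::finite multicomplex \<Rightarrow> 'n multicomplex) \<Rightarrow> (nat \<Rightarrow> 'n multicomplex) \<Rightarrow> bool"
  where "fixed_basis \<sigma> \<beta> \<longleftrightarrow> (let m = 2 ^ (CARD('n) - 1) in
    \<beta> 0 = 1 \<and> inj_on \<beta> {..<m} \<and> independent (\<beta> ` {..<m}) \<and> span (\<beta> ` {..<m}) = fixed_space \<sigma>)"

definition from_uv ::
  "'n::finite multicomplex \<Rightarrow> (nat \<Rightarrow> 'n multicomplex) \<Rightarrow> (nat \<Rightarrow> real) \<Rightarrow> (nat \<Rightarrow> real) \<Rightarrow> 'n multicomplex"
  where "from_uv i \<beta> u v = (\<Sum>l<2 ^ (CARD('n) - 1). (of_real (u l) + i * of_real (v l)) * \<beta> l)"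

text \<open>
  If \<open>e_admissible \<sigma> i\<close> and \<open>fixed_basis \<sigma> \<beta>\<close>, then the components with index below \<open>m\<close> are
  uniquely determined; the others do not enter \<open>from_uv\<close>.
\<close>

definition uv_coords ::
  "'n::finite multicomplex \<Rightarrow> (nat \<Rightarrow> 'n multicomplex) \<Rightarrow> 'n multicomplex \<Rightarrow> (nat \<Rightarrow> real) \<times> (nat \<Rightarrow> real)"
  where "uv_coords i \<beta> \<eta> = (SOME (u, v). \<eta> = from_uv i \<beta> u v)"


section \<open>Partial derivatives and differential operators\<close>

text \<open>
  Functions on an open set \<open>U\<close> are total functions of which only the values on \<open>U\<close> matter: at a
  point of \<open>U\<close>, all the derivatives below depend only on the values of \<open>F\<close> near that point.
\<close>

definition C2_on :: "'a::real_normed_vector set \<Rightarrow> ('a \<Rightarrow> 'b::real_normed_vector) \<Rightarrow> bool"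
  where "C2_on U F \<longleftrightarrow>
    (\<exists>(F' :: 'a \<Rightarrow> 'a \<Rightarrow>\<^sub>L 'b) (F'' :: 'a \<Rightarrow> 'a \<Rightarrow>\<^sub>L 'a \<Rightarrow>\<^sub>L 'b).
      (\<forall>x\<in>U. (F has_derivative blinfun_apply (F' x)) (at x)) \<and>
      (\<forall>x\<in>U. (F' has_derivative blinfun_apply (F'' x)) (at x)) \<and>
      continuous_on U F'')"

definition partial_u ::
  "'n::finite multicomplex \<Rightarrow> (nat \<Rightarrow> 'n multicomplex) \<Rightarrow> nat \<Rightarrow>
    ('n multicomplex \<Rightarrow> 'n multicomplex) \<Rightarrow> 'n multicomplex \<Rightarrow> 'n multicomplex"
  where "partial_u i \<beta> l F \<eta> = (let (u, v) = uv_coords i \<beta> \<eta> in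
    vector_derivative (\<lambda>t. F (from_uv i \<beta> (u(l := t)) v)) (at (u l)))"

definition partial_v ::
  "'n::finite multicomplex \<Rightarrow> (nat \<Rightarrow> 'n multicomplex) \<Rightarrow> nat \<Rightarrow>
    ('n multicomplex \<Rightarrow> 'n multicomplex) \<Rightarrow> 'n multicomplex \<Rightarrow> 'n multicomplex"
  where "partial_v i \<beta> l F \<eta> = (let (u, v) = uv_coords i \<beta> \<eta> in
    vector_derivative (\<lambda>t. F (from_uv i \<beta> u (v(l := t)))) (at (v l)))"

definition partial_x ::
  "bit ^ 'n \<Rightarrow> ('n::finite multicomplex \<Rightarrow> 'n multicomplex) \<Rightarrow> 'n multicomplex \<Rightarrow> 'n multicomplex"
  where "partial_x b F \<eta> =
    vector_derivative (\<lambda>t. F (\<Sum>c\<in>UNIV. ((mc_coord \<eta>)(b := t)) c *\<^sub>R mc_monomial c)) (at (mc_coord \<eta> b))"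

definition wirtinger ::
  "'n::finite multicomplex \<Rightarrow> (nat \<Rightarrow> 'n multicomplex) \<Rightarrow> nat \<Rightarrow>
    ('n multicomplex \<Rightarrow> 'n multicomplex) \<Rightarrow> 'n multicomplex \<Rightarrow> 'n multicomplex"
  where "wirtinger i \<beta> l F \<eta> = (1/2) *\<^sub>R (partial_u i \<beta> l F \<eta> - i * partial_v i \<beta> l F \<eta>)"

definition wirtinger_bar ::
  "'n::finite multicomplex \<Rightarrow> (nat \<Rightarrow> 'n multicomplex) \<Rightarrow> nat \<Rightarrow>
    ('n multicomplex \<Rightarrow> 'n multicomplex) \<Rightarrow> 'n multicomplex \<Rightarrow> 'n multicomplex"
  where "wirtinger_bar i \<beta> l F \<eta> = (1/2) *\<^sub>R (partial_u i \<beta> l F \<eta> + i * partial_v i \<beta> l F \<eta>)"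

text \<open>\<open>\<Delta>\<^sub>\<sigma>\<close>; the involution enters through the basis \<open>\<beta>\<close> of its fixed space.\<close>

definition sigma_laplacian ::
  "'n::finite multicomplex \<Rightarrow> (nat \<Rightarrow> 'n multicomplex) \<Rightarrow>
    ('n multicomplex \<Rightarrow> 'n multicomplex) \<Rightarrow> 'n multicomplex \<Rightarrow> 'n multicomplex"
  where "sigma_laplacian i \<beta> F \<eta> = (\<Sum>l<2 ^ (CARD('n) - 1).
    partial_u i \<beta> l (partial_u i \<beta> l F) \<eta> + partial_v i \<beta> l (partial_v i \<beta> l F) \<eta>)"

definition standard_laplacian ::
  "('n::finite multicomplex \<Rightarrow> 'n multicomplex) \<Rightarrow> 'n multicomplex \<Rightarrow> 'n multicomplex"
  where "standard_laplacian F \<eta> = (\<Sum>b\<in>UNIV. partial_x b (partial_x b F) \<eta>)"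

definition laplacian_adapted_basis ::
  "('n::finite multicomplex \<Rightarrow> 'n multicomplex) \<Rightarrow> 'n multicomplex \<Rightarrow> (nat \<Rightarrow> 'n multicomplex) \<Rightarrow> bool"
  where "laplacian_adapted_basis \<sigma> i \<beta> \<longleftrightarrow> fixed_basis \<sigma> \<beta> \<and>
    (\<forall>U F. open U \<longrightarrow> C2_on U F \<longrightarrow>
      (\<forall>\<eta>\<in>U. sigma_laplacian i \<beta> F \<eta> = standard_laplacian F \<eta>))"

end

theory Submission
  imports Defs
begin

text \<open>
  In the coordinates attached to a basis \<open>\<beta>\<close> of the fixed space of \<open>\<sigma>\<close>, varying \<open>u\<^sub>l\<close> means moving
  along \<open>\<beta> l\<close>, and varying \<open>v\<^sub>l\<close> means moving along \<open>i * \<beta> l\<close>. If \<open>A\<close> is the second derivative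
  of \<open>F\<close> at a point, the Wirtinger products therefore expand to
  \<open>1/4 (A \<beta>\<^sub>l \<beta>\<^sub>l - i\<^sup>2 A (i \<beta>\<^sub>l) (i \<beta>\<^sub>l) \<plusminus> i (A \<beta>\<^sub>l (i \<beta>\<^sub>l) - A (i \<beta>\<^sub>l) \<beta>\<^sub>l))\<close>. The mixed terms cancel by the
  symmetry of \<open>A\<close> (\<open>second_derivative_symmetric\<close>), and \<open>i\<^sup>2 = -1\<close> gives the factorization of the
  Laplacian (\<open>second_order_operators\<close>).

  For the comparison with the standard Laplacian, take on the multicomplex numbers the inner product
  that makes the monomials orthonormal. Both \<open>\<sigma>\<close> and multiplication by \<open>i\<close> permute the monomials
  up to sign, hence are isometries (\<open>monomial_isometry\<close>). Multiplication by \<open>i\<close> exchanges the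
  eigenspaces of \<open>\<sigma>\<close> for the eigenvalues \<open>1\<close> and \<open>-1\<close>, and these are orthogonal because
  \<open>\<sigma>\<close> is an isometry. So if \<open>\<beta>\<close> is an orthonormal basis of the fixed space, then the vectors
  \<open>\<beta> l\<close> and \<open>i * \<beta> l\<close> together are an orthonormal basis of the whole space, and \<open>\<Delta>\<^sub>\<sigma> F\<close> is the
  trace of \<open>A\<close> computed in it. The trace of a bilinear form does not depend on the orthonormal basis
  (\<open>trace_orthonormal\<close>), and in the basis of monomials it is the standard Laplacian.
  An orthonormal basis of the fixed space may be taken to contain \<open>1\<close>, which is a fixed unit vector.
\<close>

section \<open>Symmetry of the second derivative\<close>

text \<open>
  Apply the mean value inequality on \<open>{0..t}\<close> to \<open>p \<mapsto> F (x + p d + t e) - F (x + p d) - p t A e d\<close>: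
  its derivative is \<open>(F' (x + p d + t e) - F' (x + p d) - t A e) d\<close>, which is small
  compared with \<open>t\<close> because \<open>F'\<close> is differentiable at \<open>x\<close>.
\<close>

lemma second_difference_estimate:
  fixes F :: "'a::real_normed_vector \<Rightarrow> 'b::real_normed_vector" and F' :: "'a \<Rightarrow> 'a \<Rightarrow>\<^sub>L 'b"
  assumes U: "open U" "x \<in> U"
    and F: "\<And>y. y \<in> U \<Longrightarrow> (F has_derivative F' y) (at y)"
    and A: "(F' has_derivative blinfun_apply A) (at x)"
    and \<epsilon>: "\<epsilon> > 0"
  shows "\<exists>\<delta>>0. \<forall>t. 0 < t \<and> t < \<delta> \<longrightarrow>
    norm (F (x + t *\<^sub>R d + t *\<^sub>R e) - F (x + t *\<^sub>R d) - F (x + t *\<^sub>R e) + F x - t\<^sup>2 *\<^sub>R A e d)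
      \<le> \<epsilon> * t\<^sup>2"
proof -
  define M where "M = norm d + norm e + 1"
  have M: "M > 0" "norm d \<le> M" "norm d + norm e \<le> M"
    by (simp_all add: M_def add_nonneg_pos)
  obtain r where r: "r > 0" "ball x r \<subseteq> U"
    using U open_contains_ball by blast
  (* Two error terms of size c t M each are multiplied by norm d, which is at most M. *)
  define c where "c = \<epsilon> / (2 * M * M)"
  have c: "c > 0" using \<epsilon> M by (simp add: c_def)
  obtain s where s: "s > 0"
    and A': "\<And>y. norm (y - x) < s \<Longrightarrow> norm (F' y - F' x - A (y - x)) \<le> c * norm (y - x)"
    using A c unfolding has_derivative_at_alt by metis
  define \<delta> where "\<delta> = min r s / M"
  show ?thesis
  proof (intro exI [of _ \<delta>] conjI allI impI)
    show "\<delta> > 0" using r s M by (simp add: \<delta>_def)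
    fix t assume t: "0 < t \<and> t < \<delta>"
    then have tM: "t * M < r" "t * M < s"
      using M by (simp_all add: \<delta>_def pos_less_divide_eq)
    have near: "norm (p *\<^sub>R d + q *\<^sub>R e) \<le> t * M" if "p \<in> {0..t}" "q \<in> {0..t}" for p q
    proof -
      have "norm (p *\<^sub>R d + q *\<^sub>R e) \<le> norm (p *\<^sub>R d) + norm (q *\<^sub>R e)"
        by (rule norm_triangle_ineq)
      also have "\<dots> \<le> t * norm d + t * norm e"
        using that by (auto intro!: add_mono mult_right_mono)
      also have "\<dots> \<le> t * M"
        using M(3) t by (simp flip: distrib_left)
      finally show ?thesis .
    qed
    have inU: "x + p *\<^sub>R d + q *\<^sub>R e \<in> U" if "p \<in> {0..t}" "q \<in> {0..t}" for p q
      using near [OF that] tM r(2) by (auto simp: dist_norm add.assoc norm_minus_commute subset_iff)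
    have est: "norm (F' (x + p *\<^sub>R d + q *\<^sub>R e) - F' x - A (p *\<^sub>R d + q *\<^sub>R e)) \<le> c * (t * M)"
      if "p \<in> {0..t}" "q \<in> {0..t}" for p q
    proof -
      have "norm (F' (x + p *\<^sub>R d + q *\<^sub>R e) - F' x - A (p *\<^sub>R d + q *\<^sub>R e)) \<le> c * norm (p *\<^sub>R d + q *\<^sub>R e)"
        using A' [of "x + p *\<^sub>R d + q *\<^sub>R e"] near [OF that] tM by (simp add: add.assoc)
      also have "\<dots> \<le> c * (t * M)"
        using near [OF that] c by simp
      finally show ?thesis .
    qed
    define \<psi> where "\<psi> p = F (x + p *\<^sub>R d + t *\<^sub>R e) - F (x + p *\<^sub>R d + 0 *\<^sub>R e) - (p * t) *\<^sub>R A e d" for p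
    define \<psi>' where "\<psi>' p = (F' (x + p *\<^sub>R d + t *\<^sub>R e) - F' (x + p *\<^sub>R d + 0 *\<^sub>R e) - t *\<^sub>R A e) d" for p
    have der: "(\<psi> has_derivative (\<lambda>h. h *\<^sub>R \<psi>' p)) (at p within {0..t})" if p: "p \<in> {0..t}" for p
    proof -
      have *: "((\<lambda>p. F (x + p *\<^sub>R d + q *\<^sub>R e)) has_derivative
          (\<lambda>h. F' (x + p *\<^sub>R d + q *\<^sub>R e) (h *\<^sub>R d))) (at p within {0..t})" if "q \<in> {0..t}" for q
        by (rule has_derivative_compose [where f = "\<lambda>p. x + p *\<^sub>R d + q *\<^sub>R e" and g = F, OF _ F [OF inU [OF p that]]])
          (auto intro!: derivative_eq_intros)
      have "(\<psi> has_derivative (\<lambda>h. F' (x + p *\<^sub>R d + t *\<^sub>R e) (h *\<^sub>R d)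
          - F' (x + p *\<^sub>R d + 0 *\<^sub>R e) (h *\<^sub>R d) - (h * t) *\<^sub>R A e d)) (at p within {0..t})"
        unfolding \<psi>_def [abs_def]
        by (intro has_derivative_diff *) (use t in \<open>auto intro!: derivative_eq_intros\<close>)
      then show ?thesis
        by (simp add: \<psi>'_def blinfun.bilinear_simps scaleR_diff_right)
    qed
    have bound: "norm (\<psi>' p) \<le> \<epsilon> * t" if p: "p \<in> {0..t}" for p
    proof -
      have q: "0 \<in> {0..t}" "t \<in> {0..t}" using t by auto
      have "norm (\<psi>' p) \<le> norm (F' (x + p *\<^sub>R d + t *\<^sub>R e) - F' (x + p *\<^sub>R d + 0 *\<^sub>R e) - t *\<^sub>R A e) * norm d"
        unfolding \<psi>'_def by (rule norm_blinfun)
      also have "F' (x + p *\<^sub>R d + t *\<^sub>R e) - F' (x + p *\<^sub>R d + 0 *\<^sub>R e) - t *\<^sub>R A e =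
          (F' (x + p *\<^sub>R d + t *\<^sub>R e) - F' x - A (p *\<^sub>R d + t *\<^sub>R e)) -
          (F' (x + p *\<^sub>R d + 0 *\<^sub>R e) - F' x - A (p *\<^sub>R d + 0 *\<^sub>R e))"
        by (simp add: blinfun.bilinear_simps)
      also have "norm \<dots> * norm d \<le> (c * (t * M) + c * (t * M)) * M"
        using M c t
        by (intro mult_mono order_trans [OF norm_triangle_ineq4] add_mono est p q) auto
      also have "\<dots> = \<epsilon> * t"
        using M by (simp add: c_def field_simps)
      finally show ?thesis .
    qed
    have "norm (\<psi> t - \<psi> 0) \<le> (\<epsilon> * t) * norm (t - 0)"
    proof (rule differentiable_bound [OF _ der])
      show "onorm (\<lambda>h. h *\<^sub>R \<psi>' p) \<le> \<epsilon> * t" if "p \<in> {0..t}" for p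
        using bound [OF that] by (intro onorm_le) (simp add: mult.commute mult_left_mono)
    qed (use t in auto)
    moreover have "\<psi> t - \<psi> 0 = F (x + t *\<^sub>R d + t *\<^sub>R e) - F (x + t *\<^sub>R d) - F (x + t *\<^sub>R e) + F x - t\<^sup>2 *\<^sub>R A e d"
      by (simp add: \<psi>_def power2_eq_square)
    ultimately show "norm (F (x + t *\<^sub>R d + t *\<^sub>R e) - F (x + t *\<^sub>R d) - F (x + t *\<^sub>R e) + F x - t\<^sup>2 *\<^sub>R A e d)
      \<le> \<epsilon> * t\<^sup>2"
      using t by (simp add: power2_eq_square mult.assoc)
  qed
qed

text \<open>
  The second difference of \<open>F\<close> is symmetric in the two increments, so its leading coefficient is too.
\<close>

lemma second_derivative_symmetric:
  fixes F :: "'a::real_normed_vector \<Rightarrow> 'b::real_normed_vector" and F' :: "'a \<Rightarrow> 'a \<Rightarrow>\<^sub>L 'b"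
  assumes "open U" "x \<in> U"
    and "\<And>y. y \<in> U \<Longrightarrow> (F has_derivative F' y) (at y)"
    and "(F' has_derivative blinfun_apply A) (at x)"
  shows "A d e = A e d"
proof -
  have "norm (A d e - A e d) \<le> \<epsilon>" if "\<epsilon> > 0" for \<epsilon>
  proof -
    define Q where "Q t = F (x + t *\<^sub>R d + t *\<^sub>R e) - F (x + t *\<^sub>R d) - F (x + t *\<^sub>R e) + F x" for t
    have "\<epsilon> / 2 > 0" using that by simp
    from second_difference_estimate [OF assms this, of d e]
    obtain \<delta>1 where 1: "\<delta>1 > 0" "\<And>t. 0 < t \<Longrightarrow> t < \<delta>1 \<Longrightarrow> norm (Q t - t\<^sup>2 *\<^sub>R A e d) \<le> \<epsilon> / 2 * t\<^sup>2"
      unfolding Q_def by blast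
    from second_difference_estimate [OF assms \<open>\<epsilon> / 2 > 0\<close>, of e d]
    obtain \<delta>2 where 2: "\<delta>2 > 0" "\<And>t. 0 < t \<Longrightarrow> t < \<delta>2 \<Longrightarrow> norm (Q t - t\<^sup>2 *\<^sub>R A d e) \<le> \<epsilon> / 2 * t\<^sup>2"
      unfolding Q_def by (auto simp: algebra_simps)
    define t where "t = min \<delta>1 \<delta>2 / 2"
    have t: "0 < t" "t < \<delta>1" "t < \<delta>2"
      using 1(1) 2(1) by (auto simp: t_def)
    have "t\<^sup>2 * norm (A d e - A e d) = norm ((Q t - t\<^sup>2 *\<^sub>R A e d) - (Q t - t\<^sup>2 *\<^sub>R A d e))"
      by (simp flip: scaleR_diff_right)
    also have "\<dots> \<le> \<epsilon> / 2 * t\<^sup>2 + \<epsilon> / 2 * t\<^sup>2"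
      by (intro order_trans [OF norm_triangle_ineq4] add_mono 1(2) 2(2) t)
    also have "\<dots> = t\<^sup>2 * \<epsilon>"
      by simp
    finally show ?thesis
      using t by simp
  qed
  then have "norm (A d e - A e d) \<le> 0"
    by (rule field_le_epsilon) simp
  then show ?thesis by simp
qed

section \<open>Orthonormal bases\<close>

text \<open>
  Expand each standard basis vector in \<open>E\<close>; after exchanging the sums, the coefficient of
  \<open>B e e'\<close> is \<open>e \<bullet> e'\<close>.
\<close>

lemma trace_orthonormal:
  fixes B :: "'a::euclidean_space \<Rightarrow> 'a \<Rightarrow> 'b::real_vector"
  assumes B: "bilinear B" and E: "finite E" "pairwise orthogonal E" "\<And>e. e \<in> E \<Longrightarrow> norm e = 1"
    and span: "span E = UNIV"
  shows "(\<Sum>e\<in>E. B e e) = (\<Sum>b\<in>Basis. B b b)"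
proof -
  have ex: "(\<Sum>e\<in>E. (x \<bullet> e) *\<^sub>R e) = x" for x
    by (rule orthonormal_basis_expand) (use E span in auto)
  have e: "e \<bullet> e' = (if e = e' then 1 else 0)" if "e \<in> E" "e' \<in> E" for e e'
    using E that by (auto simp: pairwise_def orthogonal_def norm_eq_1)
  have inn: "(\<Sum>b\<in>Basis. (b \<bullet> x) * (b \<bullet> y)) = x \<bullet> y" for x y :: 'a
    using euclidean_inner [of x y] by (simp add: inner_commute)
  have "(\<Sum>b\<in>Basis. B b b) = (\<Sum>b\<in>Basis. B (\<Sum>e\<in>E. (b \<bullet> e) *\<^sub>R e) (\<Sum>e\<in>E. (b \<bullet> e) *\<^sub>R e))"
    by (simp add: ex)
  also have "\<dots> = (\<Sum>b\<in>Basis. \<Sum>e\<in>E. \<Sum>e'\<in>E. ((b \<bullet> e) * (b \<bullet> e')) *\<^sub>R B e e')"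
    by (simp add: bilinear_sum [OF B] bilinear_lmul [OF B] bilinear_rmul [OF B] sum.cartesian_product
        split_def mult.commute)
  also have "\<dots> = (\<Sum>e\<in>E. \<Sum>b\<in>Basis. \<Sum>e'\<in>E. ((b \<bullet> e) * (b \<bullet> e')) *\<^sub>R B e e')"
    by (rule sum.swap)
  also have "\<dots> = (\<Sum>e\<in>E. \<Sum>e'\<in>E. \<Sum>b\<in>Basis. ((b \<bullet> e) * (b \<bullet> e')) *\<^sub>R B e e')"
    by (intro sum.cong refl sum.swap)
  also have "\<dots> = (\<Sum>e\<in>E. \<Sum>e'\<in>E. (e \<bullet> e') *\<^sub>R B e e')"
    by (simp add: inn flip: scaleR_sum_left)
  also have "\<dots> = (\<Sum>e\<in>E. \<Sum>e'\<in>E. if e = e' then B e e' else 0)"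
    by (intro sum.cong refl) (simp add: e)
  also have "\<dots> = (\<Sum>e\<in>E. B e e)"
    using E(1) by simp
  finally show ?thesis ..
qed

text \<open>
  Adjoin \<open>x\<close> to an orthonormal basis of its orthogonal complement within \<open>V\<close>.
\<close>

lemma orthonormal_basis_containing:
  fixes V :: "'a::euclidean_space set"
  assumes V: "subspace V" and x: "x \<in> V" "norm x = 1"
  obtains B where "x \<in> B" "finite B" "pairwise orthogonal B" "\<And>b. b \<in> B \<Longrightarrow> norm b = 1"
    "independent B" "span B = V"
proof -
  define W where "W = {y \<in> V. orthogonal x y}"
  have "subspace W"
    using V unfolding W_def
    by (auto simp: subspace_def orthogonal_def inner_add_right)
  then obtain S where S: "S \<subseteq> W" "pairwise orthogonal S" "\<And>b. b \<in> S \<Longrightarrow> norm b = 1"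
    "independent S" "span S = W"
    by (metis orthonormal_basis_subspace)
  have orth: "pairwise orthogonal (insert x S)"
    using S(1,2) by (auto simp: pairwise_insert W_def orthogonal_commute)
  have norm: "norm b = 1" if "b \<in> insert x S" for b
    using that S(3) x by auto
  have ind: "independent (insert x S)"
    by (rule pairwise_orthogonal_independent [OF orth]) (use norm in force)
  have "span (insert x S) \<subseteq> V"
    by (rule span_minimal) (use S(1) x V in \<open>auto simp: W_def\<close>)
  moreover have "y \<in> span (insert x S)" if "y \<in> V" for y
  proof -
    have "y - (x \<bullet> y) *\<^sub>R x \<in> W"
      using that x V
      by (auto simp: W_def orthogonal_def inner_diff_right norm_eq_1 intro!: subspace_diff subspace_scale)
    then show ?thesis
      using S(5) by (auto simp: span_insert)
  qed
  ultimately have "span (insert x S) = V" by auto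
  then show ?thesis
    using that [of "insert x S"] orth norm ind independent_imp_finite [OF ind] by blast
qed

section \<open>Isometries that permute monomials up to sign\<close>

lemma Basis_multicomplex_eq: "(Basis :: 'n::finite multicomplex set) = mc_monomials"
  by (auto simp: Basis_multicomplex_def mc_monomials_def mc_monomial_eq Basis_vec_def image_iff)

lemma norm_one_multicomplex: "norm (1 :: 'n::finite multicomplex) = 1"
proof -
  have "(1 :: 'n multicomplex) \<in> Basis"
    by (auto simp: Basis_multicomplex_eq mc_monomials_def mc_monomial_eq one_multicomplex_def)
  then show ?thesis by simp
qed

text \<open>
  The monomials form an orthonormal basis. A linear injection that sends each of them to a signed
  monomial cannot send two different ones to the same monomial up to sign, so it sends this basis
  to an orthonormal family.
\<close>

lemma monomial_isometry:
  fixes f :: "'n::finite multicomplex \<Rightarrow> 'n multicomplex"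
  assumes f: "linear f" "inj f" and mono: "f ` mc_monomials \<subseteq> mc_pm_monomials"
  shows "orthogonal_transformation f"
proof -
  interpret f: linear f by fact
  have pm: "\<exists>u'\<in>Basis. f u = u' \<or> f u = - u'" if "u \<in> Basis" for u
    using mono that by (auto simp: Basis_multicomplex_eq mc_pm_monomials_def)
  have "f u \<bullet> f v = u \<bullet> v" if u: "u \<in> Basis" and v: "v \<in> Basis" for u v
  proof -
    obtain u' v' where u': "u' \<in> Basis" "f u = u' \<or> f u = - u'"
      and v': "v' \<in> Basis" "f v = v' \<or> f v = - v'"
      using pm u v by metis
    show ?thesis
    proof (cases "u = v")
      case True
      then show ?thesis using u u' by (auto simp: inner_Basis)
    next
      case False
      have "u' \<noteq> v'"
      proof
        assume "u' = v'"
        then have "f u = f v \<or> f u = f (- v)"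
          using u' v' by (auto simp: f.neg)
        then have "u = - v"
          using \<open>inj f\<close> False by (auto dest: injD)
        then have "u \<bullet> v = - 1" using v by simp
        then show False using u v False by (simp add: inner_Basis)
      qed
      then show ?thesis
        using u v u' v' False by (auto simp: inner_Basis)
    qed
  qed
  moreover have "bilinear (\<lambda>x y. f x \<bullet> f y)" "bilinear (\<lambda>x y :: 'n multicomplex. x \<bullet> y)"
    by (auto simp: bilinear_def linear_iff f.add f.scale inner_add_left inner_add_right)
  ultimately have "(\<lambda>x y. f x \<bullet> f y) = (\<lambda>x y. x \<bullet> y)"
    by (intro bilinear_eq_stdbasis) auto
  then show ?thesis
    using f by (simp add: orthogonal_transformation_def fun_eq_iff)
qed

text \<open>
  The product of two monomials is a monomial up to the sign \<open>mc_sign\<close>.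
\<close>

lemma mult_monomial_isometry:
  fixes i :: "'n::finite multicomplex"
  assumes "i \<in> mc_monomials" "i\<^sup>2 = - 1"
  shows "orthogonal_transformation ((*) i)"
proof (rule monomial_isometry)
  show "linear ((*) i)"
    by (auto simp: linear_iff distrib_left)
  have "i * (i * x) = - x" for x
    using assms(2) by (simp add: power2_eq_square flip: mult.assoc)
  then show "inj ((*) i)"
    by (metis injI neg_equal_iff_equal)
  have "mc_sign b c = 1 \<or> mc_sign b c = - 1" for b c :: "bit ^ 'n"
  proof -
    have "(\<Prod>k\<in>S. if b $ k = 1 \<and> c $ k = 1 then - 1 else 1 :: real) \<in> {1, - 1}" for S
      by (induction S rule: infinite_finite_induct) auto
    then show ?thesis by (auto simp: mc_sign_def)
  qed
  then have "mc_monomial b * mc_monomial c \<in> mc_pm_monomials" for b c :: "bit ^ 'n"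
    unfolding mc_monomial_eq Mc_axis_mult mc_pm_monomials_def mc_monomials_def
    by (metis (no_types, lifting) UnI1 UnI2 imageI mc_monomial_eq rangeI scaleR_minus1_left scaleR_one)
  then show "(*) i ` mc_monomials \<subseteq> mc_pm_monomials"
    using assms(1) by (auto simp: mc_monomials_def)
qed

section \<open>Partial derivatives as directional derivatives\<close>

text \<open>
  The partial derivatives in the different coordinate systems, as operators on functions, all
  differentiate along a fixed vector. Recording only this vector allows one argument
  for second derivatives to serve every coordinate system.
\<close>

definition derivative_along ::
  "'a \<Rightarrow> (('a::real_normed_vector \<Rightarrow> 'b::real_normed_vector) \<Rightarrow> 'a \<Rightarrow> 'b) \<Rightarrow> bool"
  where "derivative_along d P \<longleftrightarrow> (\<forall>F D x. (F has_derivative D) (at x) \<longrightarrow> P F x = D d)"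

lemma vector_derivative_line:
  assumes "(F has_derivative D) (at x)"
  shows "vector_derivative (\<lambda>t. F (x + (t - a) *\<^sub>R d)) (at a) = D d"
proof (rule vector_derivative_at)
  have "((\<lambda>t. F (x + (t - a) *\<^sub>R d)) has_derivative (\<lambda>h. D (h *\<^sub>R d))) (at a)"
    by (rule has_derivative_compose [where f = "\<lambda>t. x + (t - a) *\<^sub>R d" and g = F])
      (use assms in \<open>auto intro!: derivative_eq_intros\<close>)
  then show "((\<lambda>t. F (x + (t - a) *\<^sub>R d)) has_vector_derivative D d) (at a)"
    using assms by (simp add: has_vector_derivative_def linear_simps(5) has_derivative_bounded_linear)
qed

text \<open>
  The conclusion is about the function \<open>P F\<close> itself rather than about a formula for it on \<open>U\<close>,
  so that a second operator of the same kind can be applied to it: the value of \<open>P F\<close> is known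
  only on \<open>U\<close>, but \<open>U\<close> is open and the derivative at \<open>x\<close> does not see the rest.
\<close>

lemma second_derivative_along:
  assumes U: "open U" "x \<in> U"
    and F: "\<And>y. y \<in> U \<Longrightarrow> (F has_derivative blinfun_apply (F' y)) (at y)"
    and A: "(F' has_derivative blinfun_apply A) (at x)"
    and P: "derivative_along d P"
  shows "(P F has_derivative (\<lambda>h. A h d)) (at x)"
proof (rule has_derivative_transform_within_open [OF _ U])
  show "((\<lambda>y. F' y d) has_derivative (\<lambda>h. A h d)) (at x)"
    using A by (auto intro!: derivative_eq_intros)
  show "F' y d = P F y" if "y \<in> U" for y
    using P F [OF that] by (auto simp: derivative_along_def)
qed

lemma derivative_along_partial_x: "derivative_along (mc_monomial b :: 'n::finite multicomplex) (partial_x b)"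
  unfolding derivative_along_def
proof (intro allI impI)
  fix F D :: "'n multicomplex \<Rightarrow> 'n multicomplex" and x :: "'n multicomplex"
  assume D: "(F has_derivative D) (at x)"
  have "(\<Sum>c\<in>UNIV. ((mc_coord x)(b := t)) c *\<^sub>R mc_monomial c) =
      x + (t - mc_coord x b) *\<^sub>R mc_monomial b" for t
    by (rule mc_coord_eqI)
      (auto simp: mc_coord_sum mc_monomial_eq axis_def if_distrib [of "\<lambda>t. _ * t"] cong: if_cong)
  then show "partial_x b F x = D (mc_monomial b)"
    by (simp add: partial_x_def vector_derivative_line [OF D])
qed

text \<open>
  Changing one coordinate is a translation along \<open>\<beta> l\<close> or \<open>i * \<beta> l\<close>, which makes the partial
  derivatives directional derivatives along these vectors.
\<close>

lemma from_uv_upd: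
  fixes i :: "'n::finite multicomplex"
  assumes "l < 2 ^ (CARD('n) - 1)"
  shows "from_uv i \<beta> (u(l := t)) v = from_uv i \<beta> u v + (t - u l) *\<^sub>R \<beta> l"
    and "from_uv i \<beta> u (v(l := t)) = from_uv i \<beta> u v + (t - v l) *\<^sub>R (i * \<beta> l)"
proof -
  have "from_uv i \<beta> (u(l := t)) v = (\<Sum>k<2 ^ (CARD('n) - 1).
      (of_real (u k) + i * of_real (v k)) * \<beta> k + (if k = l then (t - u l) *\<^sub>R \<beta> l else 0))"
    unfolding from_uv_def by (intro sum.cong refl) (auto simp: scaleR_conv_of_real algebra_simps)
  then show "from_uv i \<beta> (u(l := t)) v = from_uv i \<beta> u v + (t - u l) *\<^sub>R \<beta> l"
    using assms by (simp add: sum.distrib from_uv_def)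
  have "from_uv i \<beta> u (v(l := t)) = (\<Sum>k<2 ^ (CARD('n) - 1).
      (of_real (u k) + i * of_real (v k)) * \<beta> k + (if k = l then (t - v l) *\<^sub>R (i * \<beta> l) else 0))"
    unfolding from_uv_def by (intro sum.cong refl) (auto simp: scaleR_conv_of_real algebra_simps)
  then show "from_uv i \<beta> u (v(l := t)) = from_uv i \<beta> u v + (t - v l) *\<^sub>R (i * \<beta> l)"
    using assms by (simp add: sum.distrib from_uv_def)
qed

lemma standard_laplacian_eq_trace:
  fixes F :: "'n::finite multicomplex \<Rightarrow> 'n multicomplex"
  assumes U: "open U" "\<eta> \<in> U"
    and F: "\<And>y. y \<in> U \<Longrightarrow> (F has_derivative blinfun_apply (F' y)) (at y)"
    and A: "(F' has_derivative blinfun_apply A) (at \<eta>)"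
  shows "standard_laplacian F \<eta> = (\<Sum>e\<in>Basis. A e e)"
proof -
  have "partial_x b (partial_x b F) \<eta> = A (mc_monomial b) (mc_monomial b)" for b
    using derivative_along_partial_x [of b]
      second_derivative_along [OF U F A derivative_along_partial_x [of b]]
    by (auto simp: derivative_along_def)
  moreover have "inj (mc_monomial :: bit ^ 'n \<Rightarrow> _)"
    by (auto simp: inj_def mc_monomial_eq Mc_inject axis_eq_axis)
  ultimately show ?thesis
    by (simp add: standard_laplacian_def Basis_multicomplex_eq mc_monomials_def sum.reindex)
qed

section \<open>Admissible pairs\<close>

locale e_admissible_pair =
  fixes \<sigma> :: "'n::finite multicomplex \<Rightarrow> 'n multicomplex" and i :: "'n multicomplex"
  assumes adm: "e_admissible \<sigma> i"
begin

lemma linear_sigma: "linear \<sigma>"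
  and sigma_mult: "\<sigma> (x * y) = \<sigma> x * \<sigma> y"
  and sigma_sigma [simp]: "\<sigma> (\<sigma> x) = x"
  and sigma_i: "\<sigma> i = - i"
  and i_square: "i * i = - 1"
  using adm by (auto simp: e_admissible_def mc_involution_def power2_eq_square o_def id_def fun_eq_iff)

lemma i_i_mult: "i * (i * x) = - x"
  by (simp add: i_square flip: mult.assoc)

lemma isometry_sigma: "orthogonal_transformation \<sigma>"
proof (rule monomial_isometry [OF linear_sigma])
  show "inj \<sigma>" by (metis injI sigma_sigma)
  show "\<sigma> ` mc_monomials \<subseteq> mc_pm_monomials"
    using adm by (simp add: e_admissible_def monomial_preserving_def)
qed

lemma isometry_i: "orthogonal_transformation ((*) i)"
  using adm by (intro mult_monomial_isometry) (auto simp: e_admissible_def)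

lemma subspace_fixed_space: "subspace (fixed_space \<sigma>)"
  using linear_sigma by (auto simp: subspace_def fixed_space_def linear_iff linear_0)

lemma one_in_fixed_space: "1 \<in> fixed_space \<sigma>"
  using sigma_mult [of "\<sigma> 1" 1] by (simp add: fixed_space_def)

text \<open>
  Split \<open>\<eta>\<close> into its components in the eigenspaces of \<open>\<sigma>\<close>; as \<open>\<sigma> i = -i\<close>, multiplication by \<open>i\<close>
  exchanges the two eigenspaces.
\<close>

lemma fixed_space_decomposition:
  obtains x y where "x \<in> fixed_space \<sigma>" "y \<in> fixed_space \<sigma>" "\<eta> = x + i * y"
proof
  interpret \<sigma>: linear \<sigma> by (rule linear_sigma)
  show "(1/2) *\<^sub>R (\<eta> + \<sigma> \<eta>) \<in> fixed_space \<sigma>"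
    by (simp add: fixed_space_def \<sigma>.add \<sigma>.scale add.commute)
  show "(1/2) *\<^sub>R (i * (\<sigma> \<eta> - \<eta>)) \<in> fixed_space \<sigma>"
    by (simp add: fixed_space_def \<sigma>.diff \<sigma>.scale sigma_mult sigma_i algebra_simps)
  have "\<eta> = (1/2 + 1/2) *\<^sub>R \<eta>" by simp
  then show "\<eta> = (1/2) *\<^sub>R (\<eta> + \<sigma> \<eta>) + i * (1/2) *\<^sub>R (i * (\<sigma> \<eta> - \<eta>))"
    by (simp add: i_i_mult right_diff_distrib scaleR_add_right scaleR_diff_right scaleR_add_left)
qed

text \<open>
  Eigenspaces of an isometry for different eigenvalues are orthogonal.
\<close>

lemma orthogonal_fixed_space:
  assumes "x \<in> fixed_space \<sigma>" "y \<in> fixed_space \<sigma>"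
  shows "orthogonal x (i * y)"
proof -
  have "x \<bullet> (i * y) = \<sigma> x \<bullet> \<sigma> (i * y)"
    using isometry_sigma by (simp add: orthogonal_transformation_def)
  also have "\<dots> = - (x \<bullet> (i * y))"
    using assms by (simp add: fixed_space_def sigma_mult sigma_i)
  finally show ?thesis by (simp add: orthogonal_def)
qed

lemma span_Un_mult_i:
  assumes "span S = fixed_space \<sigma>"
  shows "span (S \<union> (*) i ` S) = UNIV"
proof -
  have "linear ((*) i)"
    using isometry_i by (rule orthogonal_transformation_linear)
  then have im: "span ((*) i ` S) = (*) i ` fixed_space \<sigma>"
    by (simp add: linear_span_image assms)
  have "\<eta> \<in> {x + y |x y. x \<in> fixed_space \<sigma> \<and> y \<in> (*) i ` fixed_space \<sigma>}" for \<eta>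
    using fixed_space_decomposition [of \<eta>] by blast
  then show ?thesis
    unfolding span_Un assms im by blast
qed

lemma orthonormal_Un_mult_i:
  assumes S: "S \<subseteq> fixed_space \<sigma>" "pairwise orthogonal S" "\<And>s. s \<in> S \<Longrightarrow> norm s = 1"
  shows "pairwise orthogonal (S \<union> (*) i ` S)" (is ?A)
    and "s \<in> S \<union> (*) i ` S \<Longrightarrow> norm s = 1"
    and "S \<inter> (*) i ` S = {}"
    and "inj_on ((*) i) S"
proof -
  have inn: "(i * x) \<bullet> (i * y) = x \<bullet> y" for x y
    using isometry_i by (simp add: orthogonal_transformation_def)
  have "orthogonal s (i * t)" "orthogonal (i * t) s" if "s \<in> S" "t \<in> S" for s t
    using orthogonal_fixed_space [of s t] that S(1) by (auto simp: orthogonal_commute)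
  then show ?A
    using S(2) by (fastforce simp: pairwise_def orthogonal_def inn)
  show "norm s = 1" if "s \<in> S \<union> (*) i ` S"
    using that S(3) by (auto simp: norm_eq_1 inn)
  show "S \<inter> (*) i ` S = {}"
  proof -
    have False if "s \<in> S" "t \<in> S" "s = i * t" for s t
    proof -
      have "s \<bullet> s = 0"
        using orthogonal_fixed_space [of s t] that S(1) by (auto simp: orthogonal_def)
      then show False
        using S(3) [OF \<open>s \<in> S\<close>] by simp
    qed
    then show ?thesis by blast
  qed
  show "inj_on ((*) i) S"
    by (rule inj_onI) (metis i_i_mult neg_equal_iff_equal)
qed

section \<open>The coordinates of an admissible pair\<close>

lemma from_uv_surj:
  assumes \<beta>: "fixed_basis \<sigma> \<beta>"
  shows "\<exists>u v. \<eta> = from_uv i \<beta> u v"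
proof -
  let ?I = "{..<2 ^ (CARD('n) - 1)} :: nat set"
  have span: "span (\<beta> ` ?I) = fixed_space \<sigma>" and inj: "inj_on \<beta> ?I"
    using \<beta> by (auto simp: fixed_basis_def Let_def)
  have ex: "\<exists>u. x = (\<Sum>l\<in>?I. u l *\<^sub>R \<beta> l)" if "x \<in> fixed_space \<sigma>" for x
  proof -
    have "x \<in> range (\<lambda>u. \<Sum>b\<in>\<beta> ` ?I. u b *\<^sub>R b)"
      using that span by (simp add: span_finite)
    then obtain c where "x = (\<Sum>b\<in>\<beta> ` ?I. c b *\<^sub>R b)" by blast
    then have "x = (\<Sum>l\<in>?I. (c \<circ> \<beta>) l *\<^sub>R \<beta> l)"
      using sum.reindex [OF inj, of "\<lambda>b. c b *\<^sub>R b"] by simp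
    then show ?thesis by blast
  qed
  obtain x y where "x \<in> fixed_space \<sigma>" "y \<in> fixed_space \<sigma>" and \<eta>: "\<eta> = x + i * y"
    by (rule fixed_space_decomposition)
  with ex obtain u v where "x = (\<Sum>l\<in>?I. u l *\<^sub>R \<beta> l)" "y = (\<Sum>l\<in>?I. v l *\<^sub>R \<beta> l)"
    by meson
  then have "\<eta> = from_uv i \<beta> u v"
    by (simp add: \<eta> from_uv_def distrib_right sum.distrib sum_distrib_left scaleR_conv_of_real mult.assoc)
  then show ?thesis by blast
qed

text \<open>
  The coordinates are given by a choice among all representations of \<open>\<eta>\<close>. Since one exists, the
  chosen one represents \<open>\<eta>\<close>, and \<open>from_uv_upd\<close> then determines the partial derivatives at \<open>\<eta>\<close>.
\<close>

lemma from_uv_coords: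
  assumes "fixed_basis \<sigma> \<beta>" and uv: "uv_coords i \<beta> \<eta> = (u, v)"
  shows "from_uv i \<beta> u v = \<eta>"
proof -
  have "\<exists>p. case p of (u, v) \<Rightarrow> \<eta> = from_uv i \<beta> u v"
    using from_uv_surj [OF assms(1)] by simp
  from someI_ex [OF this] show ?thesis
    using uv by (simp add: uv_coords_def)
qed

lemma derivative_along_partial_uv:
  assumes \<beta>: "fixed_basis \<sigma> \<beta>" and l: "l < 2 ^ (CARD('n) - 1)"
  shows "derivative_along (\<beta> l) (partial_u i \<beta> l)"
    and "derivative_along (i * \<beta> l) (partial_v i \<beta> l)"
proof -
  have "partial_u i \<beta> l F \<eta> = D (\<beta> l) \<and> partial_v i \<beta> l F \<eta> = D (i * \<beta> l)"
    if D: "(F has_derivative D) (at \<eta>)" for F D \<eta>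
  proof -
    obtain u v where uv: "uv_coords i \<beta> \<eta> = (u, v)"
      by (cases "uv_coords i \<beta> \<eta>")
    show ?thesis
      by (simp add: partial_u_def partial_v_def uv from_uv_upd [OF l] from_uv_coords [OF \<beta> uv]
          vector_derivative_line [OF D])
  qed
  then show "derivative_along (\<beta> l) (partial_u i \<beta> l)" "derivative_along (i * \<beta> l) (partial_v i \<beta> l)"
    by (simp_all add: derivative_along_def)
qed

text \<open>
  The symmetry of \<open>A\<close> is what makes the two orders of composition agree: each leaves a multiple
  of \<open>A (i * \<beta> l) (\<beta> l) - A (\<beta> l) (i * \<beta> l)\<close>, with opposite signs.
\<close>

lemma second_order_operators:
  assumes \<beta>: "fixed_basis \<sigma> \<beta>" and l: "l < 2 ^ (CARD('n) - 1)"
    and U: "open U" "\<eta> \<in> U"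
    and F: "\<And>y. y \<in> U \<Longrightarrow> (F has_derivative blinfun_apply (F' y)) (at y)"
    and A: "(F' has_derivative blinfun_apply A) (at \<eta>)"
  shows "partial_u i \<beta> l (partial_u i \<beta> l F) \<eta> = A (\<beta> l) (\<beta> l)"
    and "partial_v i \<beta> l (partial_v i \<beta> l F) \<eta> = A (i * \<beta> l) (i * \<beta> l)"
    and "wirtinger i \<beta> l (wirtinger_bar i \<beta> l F) \<eta> =
      (1/4) *\<^sub>R (A (\<beta> l) (\<beta> l) + A (i * \<beta> l) (i * \<beta> l))"
    and "wirtinger_bar i \<beta> l (wirtinger i \<beta> l F) \<eta> =
      (1/4) *\<^sub>R (A (\<beta> l) (\<beta> l) + A (i * \<beta> l) (i * \<beta> l))"
proof -
  note along = derivative_along_partial_uv [OF \<beta> l]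
  note Du = second_derivative_along [OF U F A along(1)]
  note Dv = second_derivative_along [OF U F A along(2)]
  have u: "partial_u i \<beta> l G \<eta> = D (\<beta> l)" and v: "partial_v i \<beta> l G \<eta> = D (i * \<beta> l)"
    if "(G has_derivative D) (at \<eta>)" for G D
    using along that by (auto simp: derivative_along_def)
  show "partial_u i \<beta> l (partial_u i \<beta> l F) \<eta> = A (\<beta> l) (\<beta> l)"
    "partial_v i \<beta> l (partial_v i \<beta> l F) \<eta> = A (i * \<beta> l) (i * \<beta> l)"
    using u [OF Du] v [OF Dv] by simp_all
  have sym: "A (i * \<beta> l) (\<beta> l) = A (\<beta> l) (i * \<beta> l)"
    by (rule second_derivative_symmetric [OF U F A])
  have "bounded_linear ((*) i)"
    using isometry_i orthogonal_transformation_linear linear_conv_bounded_linear by blast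
  note Div = bounded_linear.has_derivative [OF this Dv]
  have "(wirtinger_bar i \<beta> l F has_derivative (\<lambda>h. (1/2) *\<^sub>R (A h (\<beta> l) + i * A h (i * \<beta> l)))) (at \<eta>)"
    unfolding wirtinger_bar_def [abs_def] by (intro has_derivative_scaleR_right has_derivative_add has_derivative_diff Du Div)
  note uv = u [OF this] v [OF this]
  show "wirtinger i \<beta> l (wirtinger_bar i \<beta> l F) \<eta> =
      (1/4) *\<^sub>R (A (\<beta> l) (\<beta> l) + A (i * \<beta> l) (i * \<beta> l))"
    unfolding wirtinger_def uv by (simp add: i_i_mult sym algebra_simps)
  have "(wirtinger i \<beta> l F has_derivative (\<lambda>h. (1/2) *\<^sub>R (A h (\<beta> l) - i * A h (i * \<beta> l)))) (at \<eta>)"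
    unfolding wirtinger_def [abs_def] by (intro has_derivative_scaleR_right has_derivative_add has_derivative_diff Du Div)
  note uv = u [OF this] v [OF this]
  show "wirtinger_bar i \<beta> l (wirtinger i \<beta> l F) \<eta> =
      (1/4) *\<^sub>R (A (\<beta> l) (\<beta> l) + A (i * \<beta> l) (i * \<beta> l))"
    unfolding wirtinger_bar_def uv by (simp add: i_i_mult sym algebra_simps)
qed

lemma wirtinger_factorization:
  assumes \<beta>: "fixed_basis \<sigma> \<beta>" and U: "open U" "C2_on U F" "\<eta> \<in> U" and l: "l < 2 ^ (CARD('n) - 1)"
  shows "wirtinger i \<beta> l (wirtinger_bar i \<beta> l F) \<eta> =
      (1/4) *\<^sub>R (partial_u i \<beta> l (partial_u i \<beta> l F) \<eta> + partial_v i \<beta> l (partial_v i \<beta> l F) \<eta>)"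
    and "wirtinger_bar i \<beta> l (wirtinger i \<beta> l F) \<eta> =
      (1/4) *\<^sub>R (partial_u i \<beta> l (partial_u i \<beta> l F) \<eta> + partial_v i \<beta> l (partial_v i \<beta> l F) \<eta>)"
proof -
  obtain F' F'' where F: "\<And>y. y \<in> U \<Longrightarrow> (F has_derivative blinfun_apply (F' y)) (at y)"
    and "\<And>y. y \<in> U \<Longrightarrow> (F' has_derivative blinfun_apply (F'' y)) (at y)"
    using U(2) unfolding C2_on_def by blast
  then have A: "(F' has_derivative blinfun_apply (F'' \<eta>)) (at \<eta>)"
    using U(3) by blast
  note second_order_operators [OF \<beta> l U(1,3) F A]
  then show "wirtinger i \<beta> l (wirtinger_bar i \<beta> l F) \<eta> =
      (1/4) *\<^sub>R (partial_u i \<beta> l (partial_u i \<beta> l F) \<eta> + partial_v i \<beta> l (partial_v i \<beta> l F) \<eta>)"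
    "wirtinger_bar i \<beta> l (wirtinger i \<beta> l F) \<eta> =
      (1/4) *\<^sub>R (partial_u i \<beta> l (partial_u i \<beta> l F) \<eta> + partial_v i \<beta> l (partial_v i \<beta> l F) \<eta>)"
    by simp_all
qed

section \<open>The adapted basis\<close>

lemma laplacian_adapted_of_orthonormal:
  assumes \<beta>: "fixed_basis \<sigma> \<beta>"
    and orth: "pairwise orthogonal (\<beta> ` {..<2 ^ (CARD('n) - 1)})"
    and norm: "\<And>l. l < 2 ^ (CARD('n) - 1) \<Longrightarrow> norm (\<beta> l) = 1"
  shows "laplacian_adapted_basis \<sigma> i \<beta>"
  unfolding laplacian_adapted_basis_def
proof (intro conjI \<beta> allI impI ballI)
  fix U and F :: "'n multicomplex \<Rightarrow> 'n multicomplex" and \<eta>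
  assume U: "open U" "C2_on U F" "\<eta> \<in> U"
  let ?I = "{..<2 ^ (CARD('n) - 1)} :: nat set"
  define S where "S = \<beta> ` ?I"
  have span: "span S = fixed_space \<sigma>" and inj: "inj_on \<beta> ?I"
    using \<beta> by (auto simp: fixed_basis_def Let_def S_def)
  have S: "S \<subseteq> fixed_space \<sigma>" "pairwise orthogonal S" "\<And>s. s \<in> S \<Longrightarrow> norm s = 1"
    using span_superset [of S] span orth norm by (auto simp: S_def)
  note E = orthonormal_Un_mult_i [OF S]
  obtain F' F'' where F: "\<And>y. y \<in> U \<Longrightarrow> (F has_derivative blinfun_apply (F' y)) (at y)"
    and "\<And>y. y \<in> U \<Longrightarrow> (F' has_derivative blinfun_apply (F'' y)) (at y)"
    using U(2) unfolding C2_on_def by blast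
  then have A: "(F' has_derivative blinfun_apply (F'' \<eta>)) (at \<eta>)"
    using U(3) by blast
  define B where "B = (\<lambda>x y. F'' \<eta> x y)"
  have B: "bilinear B"
    by (auto simp: B_def bilinear_def linear_iff blinfun.bilinear_simps)
  have "sigma_laplacian i \<beta> F \<eta> = (\<Sum>l\<in>?I. B (\<beta> l) (\<beta> l) + B (i * \<beta> l) (i * \<beta> l))"
    unfolding sigma_laplacian_def B_def
    using second_order_operators(1,2) [OF \<beta> _ U(1,3) F A] by (intro sum.cong) auto
  also have "\<dots> = (\<Sum>s\<in>S. B s s) + (\<Sum>s\<in>(*) i ` S. B s s)"
    using sum.reindex [OF inj, of "\<lambda>b. B b b"] sum.reindex [OF inj, of "\<lambda>b. B (i * b) (i * b)"]
      sum.reindex [OF E(4), of "\<lambda>s. B s s"]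
    by (simp add: sum.distrib S_def o_def)
  also have "\<dots> = (\<Sum>e\<in>S \<union> (*) i ` S. B e e)"
    by (rule sum.union_disjoint [symmetric]) (simp_all add: E(3), simp_all add: S_def)
  also have "\<dots> = (\<Sum>e\<in>Basis. B e e)"
    by (rule trace_orthonormal [OF B _ E(1,2) span_Un_mult_i [OF span]]) (simp_all add: S_def)
  also have "\<dots> = standard_laplacian F \<eta>"
    using standard_laplacian_eq_trace [OF U(1,3) F A] by (simp add: B_def)
  finally show "sigma_laplacian i \<beta> F \<eta> = standard_laplacian F \<eta>" .
qed

text \<open>
  The fixed space and its image under multiplication by \<open>i\<close> have the same dimension and fill the
  whole space, which has dimension \<open>2 ^ n\<close>.
\<close>

lemma card_orthonormal_fixed_basis:
  assumes S: "finite S" "span S = fixed_space \<sigma>" "pairwise orthogonal S" "\<And>s. s \<in> S \<Longrightarrow> norm s = 1"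
  shows "card S = 2 ^ (CARD('n) - 1)"
proof -
  have "S \<subseteq> fixed_space \<sigma>"
    using S(2) span_superset by blast
  note E = orthonormal_Un_mult_i [OF this S(3,4)]
  have "independent (S \<union> (*) i ` S)"
    by (rule pairwise_orthogonal_independent [OF E(1)]) (use E(2) [of 0] in auto)
  then have "card (S \<union> (*) i ` S) = DIM('n multicomplex)"
    using basis_card_eq_dim [of "S \<union> (*) i ` S" UNIV] span_Un_mult_i [OF S(2)] by simp
  moreover have "card (S \<union> (*) i ` S) = 2 * card S"
    using S(1) E(3,4) by (simp add: card_Un_disjoint card_image)
  moreover have "DIM('n multicomplex) = 2 ^ CARD('n)"
  proof -
    have "inj (Mc :: _ \<Rightarrow> 'n multicomplex)" by (simp add: inj_def Mc_inject)
    moreover have "CARD(bit) = card {0, 1 :: bit}"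
      by (rule arg_cong [of _ _ card]) auto
    then have "CARD(bit) = 2"
      by (simp add: numeral_2_eq_2)
    ultimately show ?thesis
      by (simp add: Basis_multicomplex_def card_image inj_on_subset)
  qed
  ultimately have "2 * card S = 2 ^ CARD('n)"
    by simp
  moreover have "CARD('n) > 0"
    by (rule zero_less_card_finite)
  ultimately show ?thesis
    by (cases "CARD('n)") auto
qed

lemma ex_laplacian_adapted_basis: "\<exists>\<beta>. laplacian_adapted_basis \<sigma> i \<beta>"
proof -
  let ?m = "2 ^ (CARD('n) - 1) :: nat"
  obtain S where S: "1 \<in> S" "finite S" "pairwise orthogonal S" "\<And>s. s \<in> S \<Longrightarrow> norm s = 1"
    "independent S" "span S = fixed_space \<sigma>"
    by (rule orthonormal_basis_containing [OF subspace_fixed_space one_in_fixed_space norm_one_multicomplex]) blast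
  have card: "card S = ?m"
    by (rule card_orthonormal_fixed_basis [OF S(2,6,3,4)])
  obtain h where h: "bij_betw h {..<?m} S"
    using ex_bij_betw_nat_finite [OF S(2)] by (auto simp: card atLeast0LessThan)
  then obtain k where k: "k < ?m" "h k = 1"
    using S(1) by (auto simp: bij_betw_def)
  (* An enumeration of S, corrected by a transposition so that it starts with 1. *)
  define \<beta> where "\<beta> = h \<circ> Transposition.transpose 0 k"
  have "bij_betw (Transposition.transpose 0 k) {..<?m} {..<?m}"
    by (rule bij_betw_byWitness [where f' = "Transposition.transpose 0 k"]) (use k in \<open>auto simp: Transposition.transpose_def\<close>)
  then have bij: "bij_betw \<beta> {..<?m} S"
    unfolding \<beta>_def using h by (rule bij_betw_trans)
  then have im: "\<beta> ` {..<?m} = S" and inj: "inj_on \<beta> {..<?m}"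
    by (auto simp: bij_betw_def)
  have "\<beta> 0 = 1"
    by (simp add: \<beta>_def k)
  then have "fixed_basis \<sigma> \<beta>"
    using S inj unfolding fixed_basis_def Let_def im by blast
  then have "laplacian_adapted_basis \<sigma> i \<beta>"
    by (rule laplacian_adapted_of_orthonormal) (use S im in auto)
  then show ?thesis by blast
qed

end

theorem proposition4p14:
  fixes \<sigma> :: "'n::finite multicomplex \<Rightarrow> 'n multicomplex" and i :: "'n multicomplex"
  assumes "e_admissible \<sigma> i"
  shows
    "(\<forall>\<beta> U F. fixed_basis \<sigma> \<beta> \<longrightarrow> open U \<longrightarrow> C2_on U F \<longrightarrow> (\<forall>\<eta>\<in>U.
        (\<forall>l < 2 ^ (CARD('n) - 1).
          wirtinger i \<beta> l (wirtinger_bar i \<beta> l F) \<eta> = wirtinger_bar i \<beta> l (wirtinger i \<beta> l F) \<eta> \<and>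
          wirtinger_bar i \<beta> l (wirtinger i \<beta> l F) \<eta> =
            (1/4) *\<^sub>R (partial_u i \<beta> l (partial_u i \<beta> l F) \<eta> + partial_v i \<beta> l (partial_v i \<beta> l F) \<eta>)) \<and>
        sigma_laplacian i \<beta> F \<eta> =
          4 *\<^sub>R (\<Sum>l < 2 ^ (CARD('n) - 1). wirtinger_bar i \<beta> l (wirtinger i \<beta> l F) \<eta>)))
     \<and> (\<exists>\<beta>. laplacian_adapted_basis \<sigma> i \<beta>)
     \<and> (\<forall>\<beta> \<sigma>' i' \<beta>'. laplacian_adapted_basis \<sigma> i \<beta> \<longrightarrow>
          e_admissible \<sigma>' i' \<longrightarrow> laplacian_adapted_basis \<sigma>' i' \<beta>' \<longrightarrow>
          (\<forall>U F. open U \<longrightarrow> C2_on U F \<longrightarrow>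
            (\<forall>\<eta>\<in>U. sigma_laplacian i \<beta> F \<eta> = sigma_laplacian i' \<beta>' F \<eta>)))"
proof (intro conjI allI impI ballI)
  interpret e_admissible_pair \<sigma> i by standard (rule assms)
  show "\<exists>\<beta>. laplacian_adapted_basis \<sigma> i \<beta>"
    by (rule ex_laplacian_adapted_basis)
  fix \<beta> U and F :: "'n multicomplex \<Rightarrow> 'n multicomplex" and \<eta>
  assume *: "fixed_basis \<sigma> \<beta>" "open U" "C2_on U F" "\<eta> \<in> U"
  note factor = wirtinger_factorization [OF *]
  show "sigma_laplacian i \<beta> F \<eta> =
      4 *\<^sub>R (\<Sum>l < 2 ^ (CARD('n) - 1). wirtinger_bar i \<beta> l (wirtinger i \<beta> l F) \<eta>)"
    unfolding sigma_laplacian_def scaleR_sum_right by (intro sum.cong) (simp_all add: factor)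
  fix l :: nat
  assume l: "l < 2 ^ (CARD('n) - 1)"
  show "wirtinger i \<beta> l (wirtinger_bar i \<beta> l F) \<eta> = wirtinger_bar i \<beta> l (wirtinger i \<beta> l F) \<eta>"
    by (simp add: factor [OF l])
  show "wirtinger_bar i \<beta> l (wirtinger i \<beta> l F) \<eta> =
      (1/4) *\<^sub>R (partial_u i \<beta> l (partial_u i \<beta> l F) \<eta> + partial_v i \<beta> l (partial_v i \<beta> l F) \<eta>)"
    by (rule factor(2) [OF l])
qed (simp add: laplacian_adapted_basis_def)

end
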